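(* (Discrete reverse Taylor formula.) Let $N\in\mathbb N$, let $X$ and $Y$ be independent $\mathbb N$-valued random variables with $\mathbb E[Y^N]<\infty$, and let $f:\mathbb N\to\mathbb R$ be a function such that $\Delta^k f(X)$ and $\Delta^k f(X+Y)$ are integrable for all $k\in\{0,\dots,N\}$. Then $$\mathbb E[f(X)]=\sum_{d\ge 0}(-1)^d\sum_{\mathbf J\in\mathbb N_*^d,\ |\mathbf J|\le N}m_Y^{(\mathbf J)}\,\mathbb E\big[\Delta^{|\mathbf J|}f(X+Y)\big]+\varepsilon_N(f,X,Y),$$ where $$\varepsilon_N(f,X,Y):=-\sum_{d\ge 0}(-1)^d\sum_{\mathbf J\in\mathbb N_*^d,\ |\mathbf J|\le N}m_Y^{(\mathbf J)}\,\delta_{N-|\mathbf J|}\big(\Delta^{|\mathbf J|}f,X,Y\big).$$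
   Context: $\mathbb N=\{0,1,2,\dots\}$, $\mathbb N_*=\mathbb N\setminus\{0\}$. $\Delta f(x)=f(x+1)-f(x)$, and $\Delta^k$ is its $k$-th iterate. For an $\mathbb N$-valued random variable $Y$ with $\mathbb E[Y^k]<\infty$, $m_Y^{(k)}:=\mathbb E\big[\binom{Y}{k}\big]$. For $d\ge1$ and $\mathbf J=(j_1,\dots,j_d)\in\mathbb N_*^d$, $|\mathbf J|=j_1+\cdots+j_d$ and $m_Y^{(\mathbf J)}:=m_Y^{(j_1)}\cdots m_Y^{(j_d)}$. By convention $\mathbb N_*^0=\{\emptyset\}$, $|\emptyset|=0$, $m_Y^{(\emptyset)}=1$. For $M\in\mathbb N$, $$\delta_M(f,X,Y):=\mathbb E\Big[\sum_{0\le j_1<\cdots<j_{M+1}<Y}\Delta^{M+1}f(X+j_1)\Big]$$ (sum over integers $j_1,\dots,j_{M+1}$); this is the remainder in the discrete Taylor formula $\mathbb E[f(X+Y)]=\sum_{k=0}^M m_Y^{(k)}\mathbb E[\Delta^k f(X)]+\delta_M(f,X,Y)$. *)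

theory Defs
  imports "HOL-Probability.Probability"
begin

definition fwd_diff :: "(nat \<Rightarrow> real) \<Rightarrow> nat \<Rightarrow> real" where
  "fwd_diff f x = f (x + 1) - f x"

definition binom_moment :: "'a measure \<Rightarrow> ('a \<Rightarrow> nat) \<Rightarrow> nat \<Rightarrow> real" where
  "binom_moment P Y k = (LINT \<omega>|P. real (Y \<omega> choose k))"

text \<open>A multi-index \<open>(j\<^sub>1, \<dots>, j\<^sub>d)\<close> of positive integers is a list of length \<open>d\<close> not containing 0, and
  \<open>|J|\<close> is \<^term>\<open>sum_list J\<close>.\<close>

definition multi_moment :: "'a measure \<Rightarrow> ('a \<Rightarrow> nat) \<Rightarrow> nat list \<Rightarrow> real" where
  "multi_moment P Y J = prod_list (map (binom_moment P Y) J)"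

definition multi_indices :: "nat \<Rightarrow> nat \<Rightarrow> nat list set" where
  "multi_indices N d = {J. length J = d \<and> 0 \<notin> set J \<and> sum_list J \<le> N}"

text \<open>The tuples \<open>0 \<le> j\<^sub>1 < \<dots> < j\<^sub>m < y\<close>.\<close>

definition increasing_tuples :: "nat \<Rightarrow> nat \<Rightarrow> nat list set" where
  "increasing_tuples m y = {js. length js = m \<and> sorted_wrt (<) js \<and> (\<forall>j\<in>set js. j < y)}"

definition taylor_remainder ::
    "'a measure \<Rightarrow> nat \<Rightarrow> (nat \<Rightarrow> real) \<Rightarrow> ('a \<Rightarrow> nat) \<Rightarrow> ('a \<Rightarrow> nat) \<Rightarrow> real" where
  "taylor_remainder P m f X Y =
     (LINT \<omega>|P. (\<Sum>js\<in>increasing_tuples (m + 1) (Y \<omega>). (fwd_diff ^^ (m + 1)) f (X \<omega> + hd js)))"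

text \<open>The series over \<open>d\<close> has only finitely many nonzero terms, because \<^term>\<open>multi_indices N d\<close> is
  empty for \<open>d > N\<close>.\<close>

definition reverse_taylor_remainder ::
    "'a measure \<Rightarrow> nat \<Rightarrow> (nat \<Rightarrow> real) \<Rightarrow> ('a \<Rightarrow> nat) \<Rightarrow> ('a \<Rightarrow> nat) \<Rightarrow> real" where
  "reverse_taylor_remainder P N f X Y =
     - (\<Sum>d. (- 1) ^ d * (\<Sum>J\<in>multi_indices N d.
          multi_moment P Y J *
          taylor_remainder P (N - sum_list J) ((fwd_diff ^^ sum_list J) f) X Y))"

lemma finite_increasing_tuples: "finite (increasing_tuples m y)"
  by (rule finite_subset[OF _ finite_lists_length_eq[of "{..<y}" m]])
     (auto simp: increasing_tuples_def)

lemma finite_multi_indices: "finite (multi_indices N d)"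
  by (rule finite_subset[OF _ finite_lists_length_eq[of "{..N}" d]])
     (auto simp: multi_indices_def dest: member_le_sum_list)

lemma multi_indices_empty:
  assumes "N < d"
  shows "multi_indices N d = {}"
proof -
  have "length J \<le> sum_list J" if "0 \<notin> set J" for J :: "nat list"
    using that by (induction J) auto
  then show ?thesis
    using assms by (fastforce simp: multi_indices_def)
qed

end

theory Submission
  imports Defs
begin

text \<open>The discrete Taylor formula of order \<open>N - |J|\<close> for \<open>\<Delta>\<^bsup>|J|\<^esup> f\<close> turns
  \<open>E[\<Delta>\<^bsup>|J|\<^esup> f(X + Y)] - \<delta>\<^bsub>N - |J|\<^esub>(\<Delta>\<^bsup>|J|\<^esup> f, X, Y)\<close> into
  \<open>\<Sum>k\<le>N - |J|. m\<^bsup>(k)\<^esup> E[\<Delta>\<^bsup>|J| + k\<^esup> f(X)]\<close>. Let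
  \<open>A\<^sub>d\<close> be the sum of \<open>m\<^bsup>(J)\<^esup> E[\<Delta>\<^bsup>|J|\<^esup> f(X)]\<close> over multi-indices \<open>J\<close> of length \<open>d\<close> with
  \<open>|J| \<le> N\<close>. Summed over such \<open>J\<close>, the term \<open>k = 0\<close> contributes \<open>A\<^sub>d\<close>, and the terms \<open>k \<ge> 1\<close>
  contribute \<open>A\<^bsub>d+1\<^esub>\<close>, because \<open>k\<close> extends \<open>J\<close> to a multi-index of length \<open>d + 1\<close>. The alternating
  sum over \<open>d\<close> then telescopes to \<open>A\<^sub>0 = E[f(X)]\<close>.\<close>

text \<open>A strictly increasing list is determined by its set of entries, so \<open>set\<close>
  and \<open>sorted_list_of_set\<close> are mutually inverse between these tuples and the
  \<open>m\<close>-element subsets of \<open>{..<y}\<close>.\<close>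

lemma card_increasing_tuples: "card (increasing_tuples m y) = y choose m"
proof -
  have fin: "finite A" if "A \<subseteq> {..<y}" for A
    using that by (rule finite_subset) simp
  have "bij_betw set (increasing_tuples m y) {A. A \<subseteq> {..<y} \<and> card A = m}"
  proof (rule bij_betw_byWitness[where f' = sorted_list_of_set])
    show "\<forall>js\<in>increasing_tuples m y. sorted_list_of_set (set js) = js"
      by (auto simp: increasing_tuples_def strict_sorted_iff sorted_list_of_set.idem_if_sorted_distinct)
    show "\<forall>A\<in>{A. A \<subseteq> {..<y} \<and> card A = m}. set (sorted_list_of_set A) = A"
      by (simp add: fin)
    show "set ` increasing_tuples m y \<subseteq> {A. A \<subseteq> {..<y} \<and> card A = m}"
      by (auto simp: increasing_tuples_def strict_sorted_iff distinct_card)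
    show "sorted_list_of_set ` {A. A \<subseteq> {..<y} \<and> card A = m} \<subseteq> increasing_tuples m y"
      by (auto simp: increasing_tuples_def fin)
  qed
  then have "card (increasing_tuples m y) = card {A. A \<subseteq> {..<y} \<and> card A = m}"
    by (rule bij_betw_same_card)
  then show ?thesis
    by (simp add: n_subsets)
qed

text \<open>Prepending a new smallest entry lengthens the tuple. This merges the double sum in the
  induction step of \<open>discrete_taylor\<close>, where the summand depends only on the new
  head.\<close>

lemma bij_betw_Cons_increasing_tuples:
  "bij_betw (\<lambda>(js, i). i # js) (SIGMA js:increasing_tuples (Suc m) y. {..<hd js})
     (increasing_tuples (Suc (Suc m)) y)"
proof (rule bij_betw_byWitness[where f' = "\<lambda>js. (tl js, hd js)"])
  have "i # js \<in> increasing_tuples (Suc (Suc m)) y"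
    if "js \<in> increasing_tuples (Suc m) y" "i < hd js" for js i
    using that by (cases js) (auto simp: increasing_tuples_def)
  then show "(\<lambda>(js, i). i # js) ` (SIGMA js:increasing_tuples (Suc m) y. {..<hd js})
      \<subseteq> increasing_tuples (Suc (Suc m)) y"
    by auto
  show "(\<lambda>js. (tl js, hd js)) ` increasing_tuples (Suc (Suc m)) y
      \<subseteq> (SIGMA js:increasing_tuples (Suc m) y. {..<hd js})"
    by (auto simp: increasing_tuples_def length_Suc_conv)
qed (auto simp: increasing_tuples_def length_Suc_conv)

lemma fwd_diff_telescope: "f (x + n) = f x + (\<Sum>i<n. fwd_diff f (x + i))"
  by (induction n) (simp_all add: fwd_diff_def)

text \<open>Induction on the order \<open>m\<close>: each remainder term is telescoped from
  \<open>x\<close> to \<open>x + hd js\<close>. The constant parts, counted by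
  \<open>card_increasing_tuples\<close>, give the next Taylor term; the rest is the next
  remainder.\<close>

lemma discrete_taylor:
  "f (x + y) = (\<Sum>k\<le>m. real (y choose k) * (fwd_diff ^^ k) f x)
     + (\<Sum>js\<in>increasing_tuples (m + 1) y. (fwd_diff ^^ (m + 1)) f (x + hd js))"
proof (induction m)
  case 0
  have "increasing_tuples 1 y = (\<lambda>j. [j]) ` {..<y}"
    by (auto simp: increasing_tuples_def length_Suc_conv)
  then show ?case
    using fwd_diff_telescope[of f x y] by (simp add: sum.reindex inj_on_def)
next
  case (Suc m)
  let ?g = "(fwd_diff ^^ (m + 1)) f"
  have "(\<Sum>js\<in>increasing_tuples (m + 1) y. ?g (x + hd js))
      = (\<Sum>js\<in>increasing_tuples (m + 1) y. ?g x + (\<Sum>i<hd js. fwd_diff ?g (x + i)))"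
    by (rule sum.cong[OF refl]) (rule fwd_diff_telescope)
  also have "\<dots> = real (y choose (m + 1)) * ?g x
      + (\<Sum>js\<in>increasing_tuples (m + 1) y. \<Sum>i<hd js. fwd_diff ?g (x + i))"
    by (simp add: sum.distrib card_increasing_tuples)
  also have "(\<Sum>js\<in>increasing_tuples (m + 1) y. \<Sum>i<hd js. fwd_diff ?g (x + i))
      = (\<Sum>(js, i)\<in>(SIGMA js:increasing_tuples (m + 1) y. {..<hd js}). fwd_diff ?g (x + i))"
    by (rule sum.Sigma) (simp_all add: finite_increasing_tuples)
  also have "\<dots> = (\<Sum>js\<in>increasing_tuples (Suc m + 1) y. fwd_diff ?g (x + hd js))"
    using sum.reindex_bij_betw[OF bij_betw_Cons_increasing_tuples,
        of "\<lambda>js. fwd_diff ?g (x + hd js)" m y]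
    by (simp add: case_prod_unfold)
  finally show ?case
    using Suc.IH by simp
qed

lemma bij_betw_Cons_multi_indices:
  "bij_betw (\<lambda>(J, k). k # J) (SIGMA J:multi_indices N d. {1..N - sum_list J})
     (multi_indices N (Suc d))"
  by (rule bij_betw_byWitness[where f' = "\<lambda>J. (tl J, hd J)"])
    (auto simp: multi_indices_def length_Suc_conv)

text \<open>The algebraic core, for an arbitrary sequence \<open>a\<close>; it is applied to the
  expectations of the iterated differences of \<open>f\<close> at \<open>X\<close>.\<close>

lemma alternating_multi_moment_sum:
  assumes "binom_moment P Y 0 = 1"
  shows "(\<Sum>d\<le>N. (- 1) ^ d * (\<Sum>J\<in>multi_indices N d. multi_moment P Y J *
           (\<Sum>k\<le>N - sum_list J. binom_moment P Y k * a (sum_list J + k)))) = a 0"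
proof -
  define A where "A d = (\<Sum>J\<in>multi_indices N d. multi_moment P Y J * a (sum_list J))" for d
  have step: "(\<Sum>J\<in>multi_indices N d. multi_moment P Y J *
      (\<Sum>k\<le>N - sum_list J. binom_moment P Y k * a (sum_list J + k))) = A d + A (Suc d)" for d
  proof -
    have split: "(\<Sum>k\<le>n. binom_moment P Y k * a (s + k))
        = a s + (\<Sum>k\<in>{1..n}. binom_moment P Y k * a (s + k))" for n s
      using assms by (simp add: atMost_atLeast0 sum.atLeast_Suc_atMost)
    have "(\<Sum>J\<in>multi_indices N d. \<Sum>k\<in>{1..N - sum_list J}.
          multi_moment P Y J * (binom_moment P Y k * a (sum_list J + k)))
        = (\<Sum>(J, k)\<in>(SIGMA J:multi_indices N d. {1..N - sum_list J}).
            multi_moment P Y J * (binom_moment P Y k * a (sum_list J + k)))"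
      by (rule sum.Sigma) (simp_all add: finite_multi_indices)
    also have "\<dots> = A (Suc d)"
      unfolding A_def
      using sum.reindex_bij_betw[OF bij_betw_Cons_multi_indices,
          of "\<lambda>J. multi_moment P Y J * a (sum_list J)" N d]
      by (simp add: case_prod_unfold multi_moment_def mult_ac add_ac)
    finally show ?thesis
      by (simp only: split distrib_left sum.distrib sum_distrib_left A_def)
  qed
  \<comment> \<open>For \<open>n = N\<close> the boundary term vanishes, since \<open>N + 1\<close>
    positive entries sum to more than \<open>N\<close>.\<close>
  have telescope: "(\<Sum>d\<le>n. (- 1) ^ d * (A d + A (Suc d))) = A 0 + (- 1) ^ n * A (Suc n)" for n
    by (induction n) (simp_all add: algebra_simps)
  have "multi_indices N 0 = {[]}"
    by (auto simp: multi_indices_def)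
  then have "A 0 = a 0"
    by (simp add: A_def multi_moment_def)
  moreover have "A (Suc N) = 0"
    by (simp add: A_def multi_indices_empty)
  ultimately show ?thesis
    by (simp add: step telescope)
qed

lemma suminf_multi_indices:
  fixes F :: "nat list \<Rightarrow> real"
  shows "(\<Sum>d. (- 1) ^ d * (\<Sum>J\<in>multi_indices N d. F J))
    = (\<Sum>d\<le>N. (- 1) ^ d * (\<Sum>J\<in>multi_indices N d. F J))"
  by (rule suminf_finite) (simp_all add: multi_indices_empty)

context prob_space
begin

lemma integrable_nat_power:
  assumes "Y \<in> measurable M (count_space UNIV)" "integrable M (\<lambda>\<omega>. real (Y \<omega>) ^ N)" "k \<le> N"
  shows "integrable M (\<lambda>\<omega>. real (Y \<omega>) ^ k)"
proof (rule Bochner_Integration.integrable_bound)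
  \<comment> \<open>The summand 1 covers \<open>Y \<omega> = 0\<close> with \<open>k = 0\<close>,
    where \<open>0 ^ 0 = 1\<close> may exceed \<open>0 ^ N\<close>.\<close>
  show "integrable M (\<lambda>\<omega>. 1 + real (Y \<omega>) ^ N)"
    using assms(2) by simp
  show "(\<lambda>\<omega>. real (Y \<omega>) ^ k) \<in> borel_measurable M"
    by (rule measurable_compose[OF assms(1)]) simp
  have "real y ^ k \<le> 1 + real y ^ N" for y
  proof (cases "y = 0")
    case False
    then have "real y ^ k \<le> real y ^ N"
      using assms(3) by (intro power_increasing) auto
    then show ?thesis
      by linarith
  qed (simp add: power_0_left)
  then show "AE \<omega> in M. norm (real (Y \<omega>) ^ k) \<le> norm (1 + real (Y \<omega>) ^ N)"
    by (intro AE_I2) (simp add: abs_of_nonneg add_nonneg_nonneg)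
qed

lemma integrable_binomial:
  assumes "Y \<in> measurable M (count_space UNIV)" "integrable M (\<lambda>\<omega>. real (Y \<omega>) ^ k)"
  shows "integrable M (\<lambda>\<omega>. real (Y \<omega> choose k))"
  using assms(2)
proof (rule Bochner_Integration.integrable_bound)
  show "(\<lambda>\<omega>. real (Y \<omega> choose k)) \<in> borel_measurable M"
    by (rule measurable_compose[OF assms(1)]) simp
  have "y choose k \<le> y ^ k" for y
    by (cases "k \<le> y") (simp_all add: binomial_le_pow binomial_eq_0)
  then have "real (y choose k) \<le> real y ^ k" for y
    by (simp only: of_nat_le_iff flip: of_nat_power)
  then show "AE \<omega> in M. norm (real (Y \<omega> choose k)) \<le> norm (real (Y \<omega>) ^ k)"
    by (intro AE_I2) simp
qed

text \<open>The pointwise formula writes the remainder as a difference of integrable functions.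
  Independence makes each product in the Taylor sum integrable and factors its expectation.\<close>

lemma discrete_taylor_expectation:
  assumes "Y \<in> measurable M (count_space UNIV)"
    and "indep_var (count_space UNIV) X (count_space UNIV) Y"
    and "integrable M (\<lambda>\<omega>. real (Y \<omega>) ^ m)"
    and "\<And>k. k \<le> m \<Longrightarrow> integrable M (\<lambda>\<omega>. (fwd_diff ^^ k) f (X \<omega>))"
    and "integrable M (\<lambda>\<omega>. f (X \<omega> + Y \<omega>))"
  shows "expectation (\<lambda>\<omega>. f (X \<omega> + Y \<omega>))
    = (\<Sum>k\<le>m. binom_moment M Y k * expectation (\<lambda>\<omega>. (fwd_diff ^^ k) f (X \<omega>)))
      + taylor_remainder M m f X Y"
proof -
  have indep: "indep_var borel (\<lambda>\<omega>. (fwd_diff ^^ k) f (X \<omega>)) borel (\<lambda>\<omega>. real (Y \<omega> choose k))" for k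
    using indep_var_compose[OF assms(2), of "(fwd_diff ^^ k) f" borel "\<lambda>y. real (y choose k)" borel]
    by (simp add: comp_def)
  have int: "integrable M (\<lambda>\<omega>. real (Y \<omega> choose k))" if "k \<le> m" for k
    using integrable_nat_power[OF assms(1,3) that] by (rule integrable_binomial[OF assms(1)])
  have int_prod: "integrable M (\<lambda>\<omega>. real (Y \<omega> choose k) * (fwd_diff ^^ k) f (X \<omega>))" if "k \<le> m" for k
    using indep_var_integrable[OF indep assms(4) int] that by (simp add: mult.commute)
  have "taylor_remainder M m f X Y = expectation
      (\<lambda>\<omega>. f (X \<omega> + Y \<omega>) - (\<Sum>k\<le>m. real (Y \<omega> choose k) * (fwd_diff ^^ k) f (X \<omega>)))"
    unfolding taylor_remainder_def
    by (rule Bochner_Integration.integral_cong) (simp_all add: discrete_taylor[of f _ _ m])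
  also have "\<dots> = expectation (\<lambda>\<omega>. f (X \<omega> + Y \<omega>))
      - (\<Sum>k\<le>m. expectation (\<lambda>\<omega>. real (Y \<omega> choose k) * (fwd_diff ^^ k) f (X \<omega>)))"
    using assms(5) int_prod
    by (subst Bochner_Integration.integral_diff) (auto simp: Bochner_Integration.integral_sum)
  also have "(\<Sum>k\<le>m. expectation (\<lambda>\<omega>. real (Y \<omega> choose k) * (fwd_diff ^^ k) f (X \<omega>)))
      = (\<Sum>k\<le>m. binom_moment M Y k * expectation (\<lambda>\<omega>. (fwd_diff ^^ k) f (X \<omega>)))"
    unfolding binom_moment_def
    using indep_var_lebesgue_integral[OF indep assms(4) int]
    by (intro sum.cong) (simp_all add: mult.commute)
  finally show ?thesis
    by simp
qed

end

theorem proposition1p1: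
  fixes P :: "'a measure" and X Y :: "'a \<Rightarrow> nat" and f :: "nat \<Rightarrow> real" and N :: nat
  assumes "prob_space P"
    and "X \<in> measurable P (count_space UNIV)"
    and "Y \<in> measurable P (count_space UNIV)"
    and "prob_space.indep_var P (count_space UNIV) X (count_space UNIV) Y"
    and "integrable P (\<lambda>\<omega>. real (Y \<omega>) ^ N)"
    and "\<And>k. k \<le> N \<Longrightarrow> integrable P (\<lambda>\<omega>. (fwd_diff ^^ k) f (X \<omega>))"
    and "\<And>k. k \<le> N \<Longrightarrow> integrable P (\<lambda>\<omega>. (fwd_diff ^^ k) f (X \<omega> + Y \<omega>))"
  shows "(LINT \<omega>|P. f (X \<omega>)) =
    (\<Sum>d. (- 1) ^ d * (\<Sum>J\<in>multi_indices N d.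
        multi_moment P Y J * (LINT \<omega>|P. (fwd_diff ^^ sum_list J) f (X \<omega> + Y \<omega>))))
    + reverse_taylor_remainder P N f X Y"
proof -
  interpret prob_space P
    by fact
  define a where "a k = expectation (\<lambda>\<omega>. (fwd_diff ^^ k) f (X \<omega>))" for k
  define b where "b k = expectation (\<lambda>\<omega>. (fwd_diff ^^ k) f (X \<omega> + Y \<omega>))" for k
  define \<delta> where "\<delta> k = taylor_remainder P (N - k) ((fwd_diff ^^ k) f) X Y" for k
  \<comment> \<open>The bound \<open>s \<le> N\<close> keeps \<open>s + k \<le> N\<close> for all
    \<open>k \<le> N - s\<close>, so the integrability assumptions cover every difference that
    occurs.\<close>
  have taylor: "b s - \<delta> s = (\<Sum>k\<le>N - s. binom_moment P Y k * a (s + k))" if "s \<le> N" for s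
  proof -
    have comp: "(fwd_diff ^^ k) ((fwd_diff ^^ s) f) = (fwd_diff ^^ (s + k)) f" for k
      by (simp add: funpow_add add.commute)
    show ?thesis
      using discrete_taylor_expectation[OF assms(3,4), of "N - s" "(fwd_diff ^^ s) f"] that
        integrable_nat_power[OF assms(3,5), of "N - s"] assms(6,7)
      by (simp add: comp a_def b_def \<delta>_def)
  qed
  have "(\<Sum>d. (- 1) ^ d * (\<Sum>J\<in>multi_indices N d. multi_moment P Y J * b (sum_list J)))
      + reverse_taylor_remainder P N f X Y
      = (\<Sum>d\<le>N. (- 1) ^ d * (\<Sum>J\<in>multi_indices N d.
          multi_moment P Y J * (b (sum_list J) - \<delta> (sum_list J))))"
    unfolding reverse_taylor_remainder_def suminf_multi_indices \<delta>_def
    by (simp add: right_diff_distrib sum_subtractf)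
  also have "\<dots> = (\<Sum>d\<le>N. (- 1) ^ d * (\<Sum>J\<in>multi_indices N d. multi_moment P Y J *
      (\<Sum>k\<le>N - sum_list J. binom_moment P Y k * a (sum_list J + k))))"
    by (intro sum.cong arg_cong2[where f = "(*)"] refl) (simp add: multi_indices_def taylor)
  also have "\<dots> = a 0"
    \<comment> \<open>The moment of order 0 is the total mass of \<open>P\<close>, which is
      1.\<close>
    by (rule alternating_multi_moment_sum) (simp add: binom_moment_def prob_space)
  finally show ?thesis
    by (simp add: a_def b_def)
qed

end
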